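(* $\chi(G^2)\le \Delta+\mu$ for every cointerval graph $G$ with maximum degree $\Delta$ and multiplicity $\mu$.
   Context: All graphs are simple. For a graph $G=(V,E)$: $N_G(v)$ is the set of neighbors of $v$; $\Delta$ is the maximum degree; the multiplicity is $\mu=\max\{|N_G(u)\cap N_G(v)|: u,v\in V,\ u\ne v\}$; $\chi$ denotes the chromatic number. The square $G^2$ is the graph on $V$ in which two distinct vertices are adjacent iff their distance in $G$ is at most $2$. $G$ is an interval graph if each vertex $v$ can be assigned a closed interval $I_v$ of the real line so that distinct $u,v$ are adjacent iff $I_u\cap I_v\ne\emptyset$; $G$ is a cointerval graph if its complement is an interval graph.
   Formalization: The formal statement assumes maximum degree Δ ≥ 2; the bound fails for Δ ≤ 1 (e.g. for K_2: Δ = 1, μ = 0, χ(G²) = 2; for edgeless graphs on at least two vertices: Δ = μ = 0, χ(G²) = 1). *)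

theory Defs
  imports "Graph_Theory.Graph_Theory"
begin

text \<open>
  A finite simple graph is a \<^locale>\<open>pair_graph\<close>: finitely many vertices, and a symmetric, irreflexive
  set of arcs, so that every edge is represented by its two orientations.
\<close>

definition neighbors :: "'a pair_pre_digraph \<Rightarrow> 'a \<Rightarrow> 'a set" where
  "neighbors G v = {w \<in> pverts G. (v, w) \<in> parcs G}"

definition max_degree :: "'a pair_pre_digraph \<Rightarrow> nat" where
  "max_degree G = Max ((\<lambda>v. card (neighbors G v)) ` pverts G)"

text \<open>The value is meaningful only if there are at least two vertices.\<close>

definition multiplicity :: "'a pair_pre_digraph \<Rightarrow> nat" where
  "multiplicity G =
     Max {card (neighbors G u \<inter> neighbors G v) | u v. u \<in> pverts G \<and> v \<in> pverts G \<and> u \<noteq> v}"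

text \<open>The distance is the weighted distance \<open>wf_digraph.\<mu>\<close> of the library with unit arc
  weights, which is infinite if there is no walk; it is unrelated to the multiplicity.\<close>

definition graph_dist :: "'a pair_pre_digraph \<Rightarrow> 'a \<Rightarrow> 'a \<Rightarrow> ereal" where
  "graph_dist G u v = wf_digraph.\<mu> (with_proj G) (\<lambda>_. 1) u v"

definition square :: "'a pair_pre_digraph \<Rightarrow> 'a pair_pre_digraph" where
  "square G = \<lparr> pverts = pverts G,
     parcs = {(u, v). u \<in> pverts G \<and> v \<in> pverts G \<and> u \<noteq> v \<and> graph_dist G u v \<le> 2} \<rparr>"

definition complement :: "'a pair_pre_digraph \<Rightarrow> 'a pair_pre_digraph" where
  "complement G = \<lparr> pverts = pverts G,
     parcs = {(u, v). u \<in> pverts G \<and> v \<in> pverts G \<and> u \<noteq> v \<and> (u, v) \<notin> parcs G} \<rparr>"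

definition interval_graph :: "'a pair_pre_digraph \<Rightarrow> bool" where
  "interval_graph G \<longleftrightarrow>
     (\<exists>l r :: 'a \<Rightarrow> real.
        (\<forall>v \<in> pverts G. l v \<le> r v) \<and>
        (\<forall>u \<in> pverts G. \<forall>v \<in> pverts G. u \<noteq> v \<longrightarrow>
           ((u, v) \<in> parcs G \<longleftrightarrow> {l u..r u} \<inter> {l v..r v} \<noteq> {})))"

definition cointerval_graph :: "'a pair_pre_digraph \<Rightarrow> bool" where
  "cointerval_graph G \<longleftrightarrow> interval_graph (complement G)"

definition proper_coloring :: "'a pair_pre_digraph \<Rightarrow> ('a \<Rightarrow> nat) \<Rightarrow> nat \<Rightarrow> bool" where
  "proper_coloring G c k \<longleftrightarrow>
     (\<forall>v \<in> pverts G. c v < k) \<and> (\<forall>(u, v) \<in> parcs G. c u \<noteq> c v)"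

definition chromatic_number :: "'a pair_pre_digraph \<Rightarrow> nat" where
  "chromatic_number G = (LEAST k. \<exists>c. proper_coloring G c k)"

end

theory Submission
  imports Defs
begin

text \<open>
  Represent the complement of \<open>G\<close> by intervals \<open>[l v, r v]\<close>, so that two vertices are adjacent in \<open>G\<close>
  iff one of their intervals lies entirely before the other. Let \<open>x\<close> minimize \<open>r\<close> and \<open>y\<close> maximize
  \<open>l\<close>. Every non-isolated vertex is a neighbor of \<open>x\<close> or of \<open>y\<close>; put \<open>M = N x \<inter> N y\<close>, \<open>A = N y - N x\<close>
  and \<open>B = N x - N y\<close>. A vertex of \<open>A\<close> and one of \<open>B\<close> are adjacent in the square only if they are
  adjacent in \<open>G\<close>, that is, if \<open>r u < l v\<close>. Give \<open>M\<close> the colors below \<open>card M\<close>, give \<open>A\<close> the next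
  colors upwards in order of increasing \<open>r\<close>, and give \<open>B\<close> the colors from \<open>\<Delta> + \<mu> - 1\<close> downwards in
  order of decreasing \<open>l\<close>. If adjacent \<open>u \<in> A\<close> and \<open>v \<in> B\<close> shared a color, then the vertices ranked
  up to \<open>u\<close> in \<open>A\<close> and up to \<open>v\<close> in \<open>B\<close> would be completely joined in \<open>G\<close>, and counting
  (common) neighbors shows that there are too many of them.
\<close>

text \<open>Provides the color order inside a class. Ties in \<open>key\<close> are broken
  arbitrarily, so ranks are distinct even if endpoints coincide.\<close>

lemma finite_ranking:
  fixes key :: "'a \<Rightarrow> 'b::linorder"
  assumes "finite S"
  obtains f where "bij_betw f S {..<card S}"
    and "\<And>u v. \<lbrakk>u \<in> S; v \<in> S; f u \<le> f v\<rbrakk> \<Longrightarrow> key u \<le> key v"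
proof -
  have "\<exists>f. bij_betw f S {..<card S} \<and> (\<forall>u\<in>S. \<forall>v\<in>S. f u \<le> f v \<longrightarrow> key u \<le> key v)"
    using assms
  \<comment> \<open>The inserted element has maximal key, so it takes the last rank. It may already
    lie in \<open>S\<close>, hence the case distinction below.\<close>
  proof (induction S rule: finite_ranking_induct[where f = key])
    case empty
    then show ?case by (simp add: bij_betw_def)
  next
    case (insert x S)
    then obtain f where f: "bij_betw f S {..<card S}"
      and mono: "\<forall>u\<in>S. \<forall>v\<in>S. f u \<le> f v \<longrightarrow> key u \<le> key v"
      by blast
    show ?case
    proof (cases "x \<in> S")
      case True
      then show ?thesis using f mono by (auto simp: insert_absorb)
    next
      case False
      let ?g = "f(x := card S)"
      have "bij_betw ?g S {..<card S}"
        using f False by (subst bij_betw_cong[where g = f]) auto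
      then have "bij_betw ?g (insert x S) (insert (card S) {..<card S})"
        using False by (metis fun_upd_same lessThan_iff less_irrefl notIn_Un_bij_betw Un_insert_right sup_bot_right)
      moreover have "insert (card S) {..<card S} = {..<card (insert x S)}"
        using False insert.hyps by auto
      moreover have "f u < card S" if "u \<in> S" for u
        using f that by (auto simp: bij_betw_def)
      then have "\<forall>u\<in>insert x S. \<forall>v\<in>insert x S. ?g u \<le> ?g v \<longrightarrow> key u \<le> key v"
        using mono insert.hyps False by (auto simp: not_le[symmetric])
      ultimately show ?thesis by metis
    qed
  qed
  then show thesis using that by blast
qed

lemma card_initial_segment:
  assumes "bij_betw f S {..<n::nat}" and "i < n"
  shows "card {u \<in> S. f u \<le> i} = Suc i"
proof -
  have "f ` {u \<in> S. f u \<le> i} = {..i}"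
    using assms by (auto simp: bij_betw_def)
  moreover have "inj_on f {u \<in> S. f u \<le> i}"
    using assms by (auto simp: bij_betw_def inj_on_def)
  ultimately show ?thesis
    by (metis card_image card_atMost)
qed

lemma graph_dist_le_2D:
  assumes "pair_wf_digraph G" and "graph_dist G u v \<le> 2" and "u \<noteq> v"
  shows "(u, v) \<in> parcs G \<or> (\<exists>w. (u, w) \<in> parcs G \<and> (w, v) \<in> parcs G)"
proof -
  interpret pair_wf_digraph G by fact
  \<comment> \<open>The strict bound 3 lets a walk be extracted from the infimum without showing
    that it is attained; costs are lengths, so below 3 means at most two arcs.\<close>
  have "(INF p\<in>{p. awalk u p v}. ereal (awalk_cost (\<lambda>_. 1) p)) < 3"
    using assms(2) unfolding graph_dist_def \<mu>_def
    by (rule le_less_trans) simp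
  then obtain p where p: "awalk u p v" and "awalk_cost (\<lambda>_. 1) p < 3"
    by (auto simp: INF_less_iff)
  moreover have "awalk_cost (\<lambda>_. 1) p = length p"
    by (simp add: awalk_cost_def sum_list_triv)
  ultimately have "length p < 3" by simp
  then consider "p = []" | e where "p = [e]" | e e' where "p = [e, e']"
    by (cases p; cases "tl p"; cases "tl (tl p)") auto
  then show ?thesis
  proof cases
    case 1
    with p \<open>u \<noteq> v\<close> show ?thesis by (simp add: awalk_Nil_iff)
  next
    case (2 e)
    with p show ?thesis by (cases e) (auto simp: awalk_Cons_iff awalk_Nil_iff)
  next
    case (3 e e')
    with p show ?thesis by (cases e; cases e') (auto simp: awalk_Cons_iff awalk_Nil_iff)
  qed
qed

lemma cointerval_representation:
  assumes "pair_graph G" and "cointerval_graph G"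
  obtains l r :: "'a \<Rightarrow> real" where "\<And>v. v \<in> pverts G \<Longrightarrow> l v \<le> r v"
    and "\<And>u v. \<lbrakk>u \<in> pverts G; v \<in> pverts G\<rbrakk> \<Longrightarrow>
           (u, v) \<in> parcs G \<longleftrightarrow> r u < l v \<or> r v < l u"
proof -
  interpret pair_graph G by fact
  have pverts_complement: "pverts (complement G) = pverts G"
    by (simp add: complement_def)
  obtain l r :: "'a \<Rightarrow> real" where lr: "\<forall>v\<in>pverts G. l v \<le> r v"
    and int: "\<forall>u\<in>pverts G. \<forall>v\<in>pverts G. u \<noteq> v \<longrightarrow>
           ((u, v) \<in> parcs (complement G) \<longleftrightarrow> {l u..r u} \<inter> {l v..r v} \<noteq> {})"
    using assms(2) pverts_complement unfolding cointerval_graph_def interval_graph_def by metis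
  have "(u, v) \<in> parcs G \<longleftrightarrow> r u < l v \<or> r v < l u"
    if "u \<in> pverts G" "v \<in> pverts G" for u v
  proof (cases "u = v")
    \<comment> \<open>On the diagonal both sides are false: there are no loops, and
      \<open>l v \<le> r v\<close>.\<close>
    case True
    then show ?thesis using lr that pair_no_loops[of "(v, v)"] by auto
  next
    case False
    then have "(u, v) \<in> parcs G \<longleftrightarrow> {l u..r u} \<inter> {l v..r v} = {}"
      using int that by (auto simp: complement_def)
    then show ?thesis using lr that by (auto simp: max_def min_def)
  qed
  then show thesis using that lr by blast
qed

lemma card_neighbors_le_max_degree:
  assumes "finite (pverts G)" and "v \<in> pverts G"
  shows "card (neighbors G v) \<le> max_degree G"
  using assms unfolding max_degree_def by (intro Max_ge) auto

lemma card_common_neighbors_le_multiplicity: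
  assumes "finite (pverts G)" and "u \<in> pverts G" and "v \<in> pverts G" and "u \<noteq> v"
  shows "card (neighbors G u \<inter> neighbors G v) \<le> multiplicity G"
  unfolding multiplicity_def
proof (rule Max_ge)
  have "{card (neighbors G u \<inter> neighbors G v) |u v. u \<in> pverts G \<and> v \<in> pverts G \<and> u \<noteq> v}
    \<subseteq> (\<lambda>(u, v). card (neighbors G u \<inter> neighbors G v)) ` (pverts G \<times> pverts G)"
    by auto
  then show "finite {card (neighbors G u \<inter> neighbors G v) |u v.
      u \<in> pverts G \<and> v \<in> pverts G \<and> u \<noteq> v}"
    using assms(1) by (meson finite_SigmaI finite_imageI finite_subset)
qed (use assms in blast)

text \<open>A vertex of degree at least 2 is a common neighbor of two of its neighbors. Degree 1
  does not suffice: the single edge has \<Delta> + \<mu> = 1, while its square needs two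
  colors.\<close>

lemma multiplicity_pos:
  assumes "pair_graph G" and "pverts G \<noteq> {}" and "max_degree G \<ge> 2"
  shows "multiplicity G \<ge> 1"
proof -
  interpret pair_graph G by fact
  have "max_degree G \<in> (\<lambda>v. card (neighbors G v)) ` pverts G"
    unfolding max_degree_def using assms(2) pair_finite_verts by (intro Max_in) auto
  then obtain w where w: "w \<in> pverts G" "card (neighbors G w) \<ge> 2"
    using assms(3) by auto
  then obtain u v where uv: "u \<in> neighbors G w" "v \<in> neighbors G w" "u \<noteq> v"
    by (metis card_le_Suc0_iff_eq card.infinite not_less_eq_eq numeral_2_eq_2 zero_le)
  then have "w \<in> neighbors G u \<inter> neighbors G v"
    using w(1) arcs_symmetric by (auto simp: neighbors_def)
  moreover have "finite (neighbors G u \<inter> neighbors G v)"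
    using pair_finite_verts by (simp add: neighbors_def)
  ultimately have "card (neighbors G u \<inter> neighbors G v) \<ge> 1"
    by (metis One_nat_def Suc_leI card_gt_0_iff empty_iff)
  then show ?thesis
    using card_common_neighbors_le_multiplicity[of G u v] uv pair_finite_verts
    by (auto simp: neighbors_def)
qed

text \<open>Two vertices of \<open>Q\<close> have all of \<open>P\<close> as common neighbors, so
  \<open>card P\<close> is at most the multiplicity, and the bound on \<open>card Q + m\<close> does
  the rest. If \<open>Q\<close> is a single vertex, the positive multiplicity pays for it.\<close>

lemma card_join_le:
  assumes "finite (pverts G)" and "multiplicity G \<ge> 1"
    and "P \<subseteq> pverts G" and "Q \<subseteq> pverts G" and "Q \<noteq> {}"
    and join: "\<And>u v. \<lbrakk>u \<in> P; v \<in> Q\<rbrakk> \<Longrightarrow> (v, u) \<in> parcs G"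
    and P: "card P + m \<le> max_degree G" and Q: "card Q + m \<le> max_degree G"
  shows "m + card P + card Q \<le> max_degree G + multiplicity G"
proof (cases "card Q \<le> 1")
  case True
  then show ?thesis using P assms(2) by linarith
next
  case False
  then obtain v w where vw: "v \<in> Q" "w \<in> Q" "v \<noteq> w"
    by (metis card_le_Suc0_iff_eq card.infinite One_nat_def zero_le)
  have "card P \<le> card (neighbors G v \<inter> neighbors G w)"
    using join vw assms(1,3) by (intro card_mono) (auto simp: neighbors_def)
  also have "\<dots> \<le> multiplicity G"
    using vw assms(1,4) by (intro card_common_neighbors_le_multiplicity) auto
  finally show ?thesis using Q by linarith
qed

lemma proper_coloring_imp_chromatic_number_le:
  "proper_coloring G c k \<Longrightarrow> chromatic_number G \<le> k"
  unfolding chromatic_number_def by (rule Least_le) blast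

theorem corollary20:
  fixes G :: "'a pair_pre_digraph"
  assumes "pair_graph G"
    and "cointerval_graph G"
    and "max_degree G \<ge> 2"
  shows "chromatic_number (square G) \<le> max_degree G + multiplicity G"
proof (cases "pverts G = {}")
  case True
  then have "proper_coloring (square G) (\<lambda>_. 0) 0"
    by (simp add: proper_coloring_def square_def)
  then show ?thesis
    using proper_coloring_imp_chromatic_number_le by fastforce
next
  case False
  interpret pair_graph G by fact
  define V where "V = pverts G"
  let ?\<Delta> = "max_degree G" and ?\<mu> = "multiplicity G"
  have V: "finite V" "V \<noteq> {}"
    using False pair_finite_verts by (auto simp: V_def)
  obtain l r :: "'a \<Rightarrow> real" where lr: "\<And>v. v \<in> V \<Longrightarrow> l v \<le> r v"
    and adj: "\<And>u v. \<lbrakk>u \<in> V; v \<in> V\<rbrakk> \<Longrightarrow> (u, v) \<in> parcs G \<longleftrightarrow> r u < l v \<or> r v < l u"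
    using cointerval_representation[OF assms(1,2)] unfolding V_def by metis
  obtain x where x: "x \<in> V" "\<And>v. v \<in> V \<Longrightarrow> r x \<le> r v"
    using ex_is_arg_min_if_finite[OF V, of r] by (auto simp: is_arg_min_linorder)
  obtain y where y: "y \<in> V" "\<And>v. v \<in> V \<Longrightarrow> l v \<le> l y"
    using ex_is_arg_min_if_finite[OF V, of "\<lambda>v. - l v"] by (auto simp: is_arg_min_linorder)
  \<comment> \<open>By the choice of \<open>x\<close> and \<open>y\<close>, \<open>L\<close> and
    \<open>R\<close> are their neighborhoods: no interval ends before that of \<open>x\<close>
    starts, and none starts after that of \<open>y\<close> ends.\<close>
  define L where "L = {v \<in> V. r x < l v}"
  define R where "R = {v \<in> V. r v < l y}"
  define M where "M = L \<inter> R"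
  define A where "A = R - L"
  define B where "B = L - R"
  have fin: "finite M" "finite A" "finite B"
    using V by (auto simp: M_def A_def B_def L_def R_def)
  have "L \<subseteq> neighbors G x" "R \<subseteq> neighbors G y"
    using adj x(1) y(1) by (auto simp: L_def R_def neighbors_def V_def)
  moreover have "finite (neighbors G v)" for v
    using V by (simp add: neighbors_def V_def)
  ultimately have "card L \<le> ?\<Delta>" "card R \<le> ?\<Delta>"
    using card_neighbors_le_max_degree V x(1) y(1) card_mono le_trans unfolding V_def by metis+
  moreover have "card L = card B + card M" "card R = card A + card M"
    using fin by (subst card_Un_disjoint[symmetric]; force simp: M_def A_def B_def intro: arg_cong[of _ _ card])+
  ultimately have BM: "card B + card M \<le> ?\<Delta>" and AM: "card A + card M \<le> ?\<Delta>"
    by auto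
  obtain f where f: "bij_betw f A {..<card A}"
    and f_mono: "\<And>u v. \<lbrakk>u \<in> A; v \<in> A; f u \<le> f v\<rbrakk> \<Longrightarrow> r u \<le> r v"
    using finite_ranking[OF fin(2), of r] by metis
  obtain g where g: "bij_betw g B {..<card B}"
    \<comment> \<open>The negated key gives rank 0 to a vertex of \<open>B\<close> with the largest
      \<open>l\<close>.\<close>
    and g_mono: "\<And>u v. \<lbrakk>u \<in> B; v \<in> B; g u \<le> g v\<rbrakk> \<Longrightarrow> - l u \<le> - l v"
    using finite_ranking[OF fin(3), of "\<lambda>v. - l v"] by metis
  obtain h where h: "bij_betw h M {..<card M}"
    using ex_bij_betw_finite_nat[OF fin(1)] by (auto simp: atLeast0LessThan)
  have rank: "\<And>v. v \<in> A \<Longrightarrow> f v < card A" "\<And>v. v \<in> B \<Longrightarrow> g v < card B"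
    "\<And>v. v \<in> M \<Longrightarrow> h v < card M"
    using f g h by (auto simp: bij_betw_def)
  have inj: "inj_on f A" "inj_on g B" "inj_on h M"
    using f g h by (auto simp: bij_betw_def)

  have A_B: "card M + f u \<noteq> ?\<Delta> + ?\<mu> - Suc (g v)"
    if u: "u \<in> A" and v: "v \<in> B" and uv: "r u < l v" for u v
  proof -
    define P where "P = {u' \<in> A. f u' \<le> f u}"
    define Q where "Q = {v' \<in> B. g v' \<le> g v}"
    have cards: "card P = Suc (f u)" "card Q = Suc (g v)"
      unfolding P_def Q_def using card_initial_segment f g rank u v by blast+
    have le: "card P \<le> card A" "card Q \<le> card B"
      using cards rank u v by (auto simp: Suc_leI)
    have "card M + card P + card Q \<le> ?\<Delta> + ?\<mu>"
    proof (rule card_join_le)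
      show "(v', u') \<in> parcs G" if "u' \<in> P" "v' \<in> Q" for u' v'
      proof -
        \<comment> \<open>The chain is \<open>r u' \<le> r u < l v \<le> l v'\<close>.\<close>
        have "r u' < l v'"
          using f_mono[of u' u] g_mono[of v' v] that u v uv by (auto simp: P_def Q_def)
        moreover have "u' \<in> V" "v' \<in> V"
          using that by (auto simp: P_def Q_def A_def B_def R_def L_def)
        ultimately show ?thesis using adj by blast
      qed
      show "1 \<le> ?\<mu>" using multiplicity_pos assms(1,3) False by blast
      show "Q \<noteq> {}" using v by (auto simp: Q_def)
      show "P \<subseteq> pverts G" "Q \<subseteq> pverts G"
        by (auto simp: P_def Q_def A_def B_def R_def L_def V_def)
    qed (use V AM BM le in \<open>auto simp: V_def\<close>)
    \<comment> \<open>Ranks start at 0, so a shared color would give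
      \<open>card M + card P + card Q = ?\<Delta> + ?\<mu> + 1\<close>.\<close>
    then show ?thesis using cards by linarith
  qed

  \<comment> \<open>\<open>Suc (g v)\<close> makes the highest color \<Delta> + \<mu> - 1. The
    default 0 reaches only isolated vertices, by \<open>LR\<close> below.\<close>
  define c where "c v =
    (if v \<in> M then h v else if v \<in> A then card M + f v
     else if v \<in> B then ?\<Delta> + ?\<mu> - Suc (g v) else 0)" for v
  have c_M: "c v = h v" if "v \<in> M" for v
    using that by (simp add: c_def)
  have c_A: "c v = card M + f v" if "v \<in> A" for v
    using that by (auto simp: c_def M_def A_def)
  have c_B: "c v = ?\<Delta> + ?\<mu> - Suc (g v)" if "v \<in> B" for v
    using that by (auto simp: c_def M_def A_def B_def)
  have M_lt: "c v < card M" if "v \<in> M" for v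
    using rank(3) that by (simp add: c_M)
  \<comment> \<open>The descending colors of \<open>B\<close> never enter the range of
    \<open>M\<close>, since \<open>card B + card M \<le> ?\<Delta>\<close>.\<close>
  have M_le: "card M \<le> c v" if "v \<in> A \<union> B" for v
    using that rank(2)[of v] BM by (auto simp: c_A c_B)
  have bound: "c v < ?\<Delta> + ?\<mu>" for v
  proof -
    consider "v \<in> M" | "v \<in> A" | "v \<in> B" | "v \<notin> M \<union> A \<union> B" by blast
    then show ?thesis
    proof cases
      case 1
      then show ?thesis using M_lt[of v] BM by linarith
    next
      case 2
      then show ?thesis using rank(1)[of v] AM by (simp add: c_A)
    next
      case 3
      then show ?thesis using rank(2)[of v] BM by (simp add: c_B)
    next
      case 4
      then show ?thesis using assms(3) by (simp add: c_def)
    qed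
  qed

  have proper: "c u \<noteq> c v" if sq: "(u, v) \<in> parcs (square G)" for u v
  proof -
    have uv: "u \<in> V" "v \<in> V" "u \<noteq> v"
      and path: "(u, v) \<in> parcs G \<or> (\<exists>w. (u, w) \<in> parcs G \<and> (w, v) \<in> parcs G)"
      using sq graph_dist_le_2D[OF pair_wf_digraph_axioms] by (auto simp: square_def V_def)
    have LR: "a \<in> M \<union> A \<union> B" if "(a, b) \<in> parcs G \<or> (b, a) \<in> parcs G" for a b
    proof -
      have ab: "a \<in> V" "b \<in> V"
        using that by (auto simp: V_def dest: in_arcsD1 in_arcsD2)
      then have "r a < l b \<or> r b < l a"
        using adj that by blast
      \<comment> \<open>If \<open>r b < l a\<close>, then \<open>r x \<le> r b\<close> puts
        \<open>a\<close> into \<open>L\<close>; if \<open>r a < l b\<close>, then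
        \<open>l b \<le> l y\<close> puts it into \<open>R\<close>.\<close>
      then have "a \<in> L \<union> R"
        using x(2)[OF ab(2)] y(2)[OF ab(2)] ab by (auto simp: L_def R_def)
      then show ?thesis by (auto simp: M_def A_def B_def)
    qed
    have AB: "c a \<noteq> c b"
      if "a \<in> A" "b \<in> B"
        and path: "(a, b) \<in> parcs G \<or> (\<exists>w. (a, w) \<in> parcs G \<and> (w, b) \<in> parcs G)" for a b
    proof -
      have ab: "a \<in> V" "b \<in> V" "l a \<le> r x" "l y \<le> r b"
        using that by (auto simp: A_def B_def L_def R_def)
      \<comment> \<open>No interval lies before that of \<open>a\<close> or after that of \<open>b\<close>, so a common neighbor lies between them.\<close>
      have "r a < l b"
        using path
      proof
        assume "(a, b) \<in> parcs G"
        then show ?thesis using adj[OF ab(1,2)] x(2)[OF ab(2)] ab(3) by linarith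
      next
        assume "\<exists>w. (a, w) \<in> parcs G \<and> (w, b) \<in> parcs G"
        then obtain w where w: "(a, w) \<in> parcs G" "(w, b) \<in> parcs G" by blast
        then have wV: "w \<in> V" by (auto simp: V_def dest: in_arcsD2)
        have "r a < l w"
          using adj[OF ab(1) wV] w(1) x(2)[OF wV] ab(3) by linarith
        moreover have "r w < l b"
          using adj[OF wV ab(2)] w(2) y(2)[OF wV] ab(4) by linarith
        ultimately show ?thesis using lr[OF wV] by linarith
      qed
      then show ?thesis using A_B that by (simp add: c_A c_B)
    qed
    have "(v, u) \<in> parcs G \<or> (\<exists>w. (v, w) \<in> parcs G \<and> (w, u) \<in> parcs G)"
      using path arcs_symmetric by blast
    note AB' = AB[OF _ _ path] AB[OF _ _ this]
    have "u \<in> M \<union> A \<union> B" "v \<in> M \<union> A \<union> B"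
      using path LR by blast+
    then consider "u \<in> M" "v \<in> M" | "u \<in> A" "v \<in> A" | "u \<in> B" "v \<in> B"
      | "u \<in> M" "v \<in> A \<union> B" | "v \<in> M" "u \<in> A \<union> B"
      | "u \<in> A" "v \<in> B" | "v \<in> A" "u \<in> B"
      by blast
    then show ?thesis
    proof cases
      case 1
      then show ?thesis using inj uv by (simp add: c_M inj_on_eq_iff)
    next
      case 2
      then show ?thesis using inj uv by (simp add: c_A inj_on_eq_iff)
    next
      case 3
      \<comment> \<open>Distinct ranks give distinct colors because the subtraction in
        \<open>c_B\<close> does not truncate: ranks in \<open>B\<close> are below
        \<open>card B \<le> ?\<Delta>\<close>.\<close>
      moreover have "g u \<noteq> g v" using 3 inj uv by (simp add: inj_on_eq_iff)
      ultimately show ?thesis using rank(2)[of u] rank(2)[of v] BM by (simp add: c_B)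
    next
      case 4
      then show ?thesis using M_lt[of u] M_le[of v] by linarith
    next
      case 5
      then show ?thesis using M_lt[of v] M_le[of u] by linarith
    next
      case 6
      then show ?thesis using AB' by blast
    next
      case 7
      then show ?thesis using AB' by metis
    qed
  qed
  have "proper_coloring (square G) c (?\<Delta> + ?\<mu>)"
    using bound proper by (auto simp: proper_coloring_def)
  then show ?thesis
    by (rule proper_coloring_imp_chromatic_number_le)
qed

end
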